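(* Let $a>0$ and $b>0$, and let $g(x;a,b)$ be the density of the beta-exponential distribution with parameters $a$ and $b$. For any $b>0$, the function $x\mapsto g(x;a,b)$ is log-convex on $(0,+\infty)$ if $0<a<1$, and log-concave on $(0,+\infty)$ if $a>1$.
   Context: The beta-exponential density with parameters $a,b>0$ is $g(x;a,b)=\frac{1}{B(a,b)}(1-\mathrm{e}^{-x})^{a-1}\mathrm{e}^{-bx}\mathbf{1}_{(0,+\infty)}(x)$, where $B(a,b)=\int_0^{+\infty}(1-\mathrm{e}^{-x})^{a-1}\mathrm{e}^{-bx}\,\mathrm{d}x$ is the beta function. A positive function $h$ on an interval is log-convex (resp. log-concave) if $\ln h$ is convex (resp. concave) on that interval. *)

theory Defs
  imports "HOL-Analysis.Analysis"
begin

definition beta_exp_kernel :: "real \<Rightarrow> real \<Rightarrow> real \<Rightarrow> real" where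
  "beta_exp_kernel a b x = (1 - exp (- x)) powr (a - 1) * exp (- b * x)"

definition beta_exp_const :: "real \<Rightarrow> real \<Rightarrow> real" where
  "beta_exp_const a b = set_lebesgue_integral lborel {0<..} (beta_exp_kernel a b)"

definition beta_exp_density :: "real \<Rightarrow> real \<Rightarrow> real \<Rightarrow> real" where
  "beta_exp_density a b x =
     1 / beta_exp_const a b * beta_exp_kernel a b x * indicat_real {0<..} x"

text \<open>Positivity is part of both notions because \<open>ln\<close> is total on the reals.\<close>

definition log_convex_on :: "real set \<Rightarrow> (real \<Rightarrow> real) \<Rightarrow> bool" where
  "log_convex_on S h \<longleftrightarrow> (\<forall>x\<in>S. 0 < h x) \<and> convex_on S (\<lambda>x. ln (h x))"

definition log_concave_on :: "real set \<Rightarrow> (real \<Rightarrow> real) \<Rightarrow> bool" where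
  "log_concave_on S h \<longleftrightarrow> (\<forall>x\<in>S. 0 < h x) \<and> concave_on S (\<lambda>x. ln (h x))"

text \<open>The substitution \<open>t = 1 - exp (- x)\<close> identifies the normalising integral with the
  library's Beta function; integrability excludes the default value 0 of a divergent
  Bochner integral.\<close>

lemma
  fixes a b :: real
  assumes "0 < a" and "0 < b"
  shows beta_exp_kernel_integrable: "set_integrable lborel {0<..} (beta_exp_kernel a b)"
    and beta_exp_const_eq_Beta: "beta_exp_const a b = Beta a b"
proof -
  let ?h = "\<lambda>t::real. t powr (a - 1) * (1 - t) powr (b - 1)"
  let ?g = "\<lambda>x::real. 1 - exp (- x)"
  have img: "?g ` {0<..} = {0<..<1}"
  proof (intro set_eqI iffI)
    fix t :: real assume t: "t \<in> {0<..<1}"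
    then have "t = ?g (- ln (1 - t))" "- ln (1 - t) \<in> {0<..}" by auto
    then show "t \<in> ?g ` {0<..}" by blast
  qed auto
  have I: "(?h has_integral Beta a b) {0<..<1}"
    using has_integral_Beta_real[OF assms] by (simp add: has_integral_Icc_iff_Ioo)
  have abs_h: "?h absolutely_integrable_on {0<..<1}"
    using I by (intro nonnegative_absolutely_integrable_1) (auto simp: integrable_on_def)
  have kernel: "\<bar>exp (- x)\<bar> * ?h (?g x) = beta_exp_kernel a b x" for x
  proof -
    have "exp (- x) powr (b - 1) = exp (- (b - 1) * x)"
      by (simp add: powr_def algebra_simps)
    then have "exp (- x) * exp (- x) powr (b - 1) = exp (- b * x)"
      by (simp add: exp_add[symmetric] algebra_simps)
    then show ?thesis by (simp add: beta_exp_kernel_def algebra_simps)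
  qed
  have "(\<lambda>x. \<bar>exp (- x)\<bar> * ?h (?g x)) absolutely_integrable_on {0<..} \<and>
        integral {0<..} (\<lambda>x. \<bar>exp (- x)\<bar> * ?h (?g x)) = Beta a b \<longleftrightarrow>
        ?h absolutely_integrable_on (?g ` {0<..}) \<and> integral (?g ` {0<..}) ?h = Beta a b"
    by (rule has_absolute_integral_change_of_variables_1')
       (auto intro!: derivative_eq_intros inj_onI)
  with abs_h I have "(\<lambda>x. \<bar>exp (- x)\<bar> * ?h (?g x)) absolutely_integrable_on {0<..} \<and>
        integral {0<..} (\<lambda>x. \<bar>exp (- x)\<bar> * ?h (?g x)) = Beta a b"
    unfolding img by (simp add: integral_unique)
  then have A: "beta_exp_kernel a b absolutely_integrable_on {0<..}"
      and B: "integral {0<..} (beta_exp_kernel a b) = Beta a b"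
    unfolding kernel by auto
  have meas: "set_borel_measurable lborel {0<..} (beta_exp_kernel a b)"
    unfolding set_borel_measurable_def beta_exp_kernel_def by measurable
  show int: "set_integrable lborel {0<..} (beta_exp_kernel a b)"
    using A meas unfolding set_integrable_def set_borel_measurable_def
    by (simp add: integrable_completion)
  show "beta_exp_const a b = Beta a b"
    unfolding beta_exp_const_def using set_borel_integral_eq_integral(2)[OF int] B by simp
qed

end

theory Submission
  imports Defs
begin

text \<open>On the positive axis the log-density is \<open>(a - 1) * ln (1 - exp (- x))\<close> plus
  an affine function of \<open>x\<close>, so only the first term can bend. Differentiating twice
  (\<open>has_real_derivative_ln_beta_exp_density\<close> and
  \<open>has_real_derivative_ln_beta_exp_density_deriv\<close>) gives \<open>1 - a\<close> times a
  positive function, and the sign of \<open>1 - a\<close> decides between convex and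
  concave.\<close>

lemma beta_exp_const_pos: "0 < a \<Longrightarrow> 0 < b \<Longrightarrow> 0 < beta_exp_const a b"
  by (simp add: beta_exp_const_eq_Beta Beta_def Gamma_real_pos)

lemma beta_exp_density_pos:
  assumes "0 < a" and "0 < b" and "0 < x"
  shows "0 < beta_exp_density a b x"
  using assms beta_exp_const_pos[of a b]
  by (simp add: beta_exp_density_def beta_exp_kernel_def)

lemma ln_beta_exp_density:
  assumes "0 < a" and "0 < b" and "0 < x"
  shows "ln (beta_exp_density a b x) =
         (a - 1) * ln (1 - exp (- x)) - b * x - ln (beta_exp_const a b)"
  using assms beta_exp_const_pos[of a b]
  by (simp add: beta_exp_density_def beta_exp_kernel_def ln_mult ln_div ln_powr)

lemma has_real_derivative_ln_beta_exp_density: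
  assumes "0 < a" and "0 < b" and "0 < x"
  shows "((\<lambda>x. ln (beta_exp_density a b x)) has_real_derivative
          ((a - 1) / (exp x - 1) - b)) (at x)"
\<comment> \<open>The closed form of the logarithm is available only for positive arguments, so its
  derivative is transferred through the open set \<open>{0<..}\<close>.\<close>
proof (rule has_field_derivative_transform_within_open[of _ _ _ "{0<..}"])
  show "((\<lambda>x. (a - 1) * ln (1 - exp (- x)) - b * x - ln (beta_exp_const a b))
          has_real_derivative ((a - 1) / (exp x - 1) - b)) (at x)"
  proof -
    have "exp (- x) / (1 - exp (- x)) = 1 / (exp x - 1)"
      using assms(3) by (simp add: exp_minus divide_simps)
    then have "exp (- x) * (a - 1) / (1 - exp (- x)) = (a - 1) / (exp x - 1)"
      by (metis mult.commute mult_1 times_divide_eq_right)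
    then show ?thesis
      using assms(3) by (auto intro!: derivative_eq_intros)
  qed
qed (use assms in \<open>auto simp: ln_beta_exp_density\<close>)

text \<open>The linear term contributes only the constant \<open>- b\<close> to the slope, so the
  curvature is independent of \<open>b\<close>.\<close>

lemma has_real_derivative_ln_beta_exp_density_deriv:
  assumes "0 < x"
  shows "((\<lambda>x. (a - 1) / (exp x - 1) - b) has_real_derivative
          ((1 - a) * exp x / (exp x - 1)\<^sup>2)) (at (x::real))"
  using assms by (auto intro!: derivative_eq_intros simp: field_simps power2_eq_square)

theorem proposition1:
  fixes a b :: real
  assumes "0 < a" and "0 < b"
  shows "(a < 1 \<longrightarrow> log_convex_on {0<..} (beta_exp_density a b)) \<and>
         (1 < a \<longrightarrow> log_concave_on {0<..} (beta_exp_density a b))"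
proof (intro conjI impI)
  note d1 = has_real_derivative_ln_beta_exp_density[OF assms]
  note d2 = has_real_derivative_ln_beta_exp_density_deriv[of _ a b]
  show "log_convex_on {0<..} (beta_exp_density a b)" if "a < 1"
    unfolding log_convex_on_def
  proof
    show "convex_on {0<..} (\<lambda>x. ln (beta_exp_density a b x))"
      by (rule f''_ge0_imp_convex[OF _ d1 d2]) (use that in auto)
  qed (use assms in \<open>simp add: beta_exp_density_pos\<close>)
  show "log_concave_on {0<..} (beta_exp_density a b)" if "1 < a"
    unfolding log_concave_on_def
  proof
    show "concave_on {0<..} (\<lambda>x. ln (beta_exp_density a b x))"
      \<comment> \<open>For \<open>1 < a\<close> the numerator \<open>(1 - a) * exp x\<close> is
        negative over a square.\<close>
      by (rule f''_le0_imp_concave[OF _ d1 d2])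
         (use that in \<open>auto intro!: divide_nonpos_nonneg mult_nonpos_nonneg\<close>)
  qed (use assms in \<open>simp add: beta_exp_density_pos\<close>)
qed

end
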